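(* Let $\pi$ be a monoid, let $A=(\{A_\varphi\}_{\varphi\in\pi},\{\mu_{p,q}\}_{p,q\in\pi})$ be a unital T-algebra over $K$, let $\lambda\in K$, and let $R=\{R_\varphi:A_\varphi\to A_\varphi\}_{\varphi\in\pi}$ be a family of linear maps that is left $A$-linear in the sense that $R_{pq}(a\cdot_{p,q}b)=a\cdot_{p,q}R_q(b)$ for all $p,q\in\pi$, $a\in A_p$, $b\in A_q$. Then $(A,R)$ is a Rota-Baxter T-algebra of weight $\lambda$ if and only if $R$ is T-quasi-idempotent of weight $\lambda$.
   Context: $K$ is a field; all vector spaces, tensor products and linear maps are over $K$. For a semigroup $\pi$, a T-algebra is a family of vector spaces $\{A_\varphi\}_{\varphi\in\pi}$ with linear maps $\mu_{p,q}:A_p\otimes A_q\to A_{pq}$ ($p,q\in\pi$), written $\mu_{p,q}(a\otimes b)=a\cdot_{p,q}b$, such that $(a\cdot_{p,q}b)\cdot_{pq,t}c=a\cdot_{p,qt}(b\cdot_{q,t}c)$ for all $p,q,t\in\pi$, $a\in A_p,b\in A_q,c\in A_t$. If $\pi$ is a monoid with unit $1$, the T-algebra is unital if there is a linear map $\eta:K\to A_1$ with $a\cdot_{p,1}\eta(1_K)=a=\eta(1_K)\cdot_{1,p}a$ for all $p\in\pi$, $a\in A_p$. A Rota-Baxter T-algebra of weight $\lambda\in K$, denoted $(A,R)$, is a T-algebra $A$ with a family of linear maps $R=\{R_\varphi:A_\varphi\to A_\varphi\}_{\varphi\in\pi}$ such that $R_p(a)\cdot_{p,q}R_q(b)=R_{pq}\big(R_p(a)\cdot_{p,q}b+a\cdot_{p,q}R_q(b)+\lambda\,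 a\cdot_{p,q}b\big)$ for all $p,q\in\pi$, $a\in A_p$, $b\in A_q$. A family $R=\{R_\varphi:A_\varphi\to A_\varphi\}_{\varphi\in\pi}$ of linear maps is T-quasi-idempotent of weight $\lambda$ if $R_\varphi^2=-\lambda R_\varphi$ for all $\varphi\in\pi$. *)

theory Defs
  imports "HOL-Algebra.Module" "HOL-Algebra.AbelCoset"
begin

text \<open>
  A vector space over the field \<open>K\<close> is a \<^locale>\<open>module\<close> over \<open>K\<close>.  A family of vector spaces
  indexed by \<open>P\<close> is a function \<open>A\<close> from indices to module records; its members share an element
  type but may have arbitrary carriers and operations.  Maps between carriers are HOL functions
  whose values outside the carrier do not matter.
\<close>

definition linear_hom ::
    "('k, 'r) ring_scheme \<Rightarrow> ('k, 'a, 'm) module_scheme \<Rightarrow> ('k, 'b, 'n) module_scheme \<Rightarrow> ('a \<Rightarrow> 'b) set"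
  where "linear_hom K M N =
    {f \<in> hom (add_monoid M) (add_monoid N).
       \<forall>k \<in> carrier K. \<forall>x \<in> carrier M. f (k \<odot>\<^bsub>M\<^esub> x) = k \<odot>\<^bsub>N\<^esub> f x}"

definition self_module :: "('k, 'r) ring_scheme \<Rightarrow> ('k, 'k) module"
  where "self_module K =
    \<lparr>carrier = carrier K, mult = mult K, one = one K, zero = zero K, add = add K, smult = mult K\<rparr>"

section \<open>Tensor products\<close>

text \<open>
  The tensor product is the free module on the product of the carriers modulo the bilinearity
  relations.  The ring fields \<^const>\<open>mult\<close> and \<^const>\<open>one\<close> of the module records play no role.
\<close>

definition free_module :: "('k, 'r) ring_scheme \<Rightarrow> 'x set \<Rightarrow> ('k, 'x \<Rightarrow> 'k) module"
  where "free_module K X =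
    \<lparr>carrier = {f. (\<forall>x \<in> X. f x \<in> carrier K) \<and> (\<forall>x. x \<notin> X \<longrightarrow> f x = \<zero>\<^bsub>K\<^esub>) \<and> finite {x. f x \<noteq> \<zero>\<^bsub>K\<^esub>}},
     mult = undefined, one = undefined,
     zero = (\<lambda>x. \<zero>\<^bsub>K\<^esub>), add = (\<lambda>f g x. f x \<oplus>\<^bsub>K\<^esub> g x), smult = (\<lambda>k f x. k \<otimes>\<^bsub>K\<^esub> f x)\<rparr>"

definition free_gen :: "('k, 'r) ring_scheme \<Rightarrow> 'x \<Rightarrow> 'x \<Rightarrow> 'k"
  where "free_gen K x = (\<lambda>y. if y = x then \<one>\<^bsub>K\<^esub> else \<zero>\<^bsub>K\<^esub>)"

definition submodule_span ::
    "('k, 'r) ring_scheme \<Rightarrow> ('k, 'a, 'm) module_scheme \<Rightarrow> 'a set \<Rightarrow> 'a set"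
  where "submodule_span K M S = \<Inter>{H. submodule H K M \<and> S \<subseteq> H}"

text \<open>The scalar multiple of a coset \<open>H + x\<close> is the coset \<open>H + k x\<close>; for \<open>k = 0\<close> this differs from
  the elementwise image of the coset, hence the summand \<open>H\<close>.\<close>

definition quotient_module :: "('k, 'a, 'm) module_scheme \<Rightarrow> 'a set \<Rightarrow> ('k, 'a set) module"
  where "quotient_module M H =
    \<lparr>carrier = a_rcosets\<^bsub>M\<^esub> H, mult = undefined, one = undefined,
     zero = H, add = set_add M, smult = (\<lambda>k Y. H <+>\<^bsub>M\<^esub> ((\<lambda>y. k \<odot>\<^bsub>M\<^esub> y) ` Y))\<rparr>"

definition tensor_relations ::
    "('k, 'r) ring_scheme \<Rightarrow> ('k, 'a, 'm) module_scheme \<Rightarrow> ('k, 'b, 'n) module_scheme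
      \<Rightarrow> ('a \<times> 'b \<Rightarrow> 'k) set"
  where "tensor_relations K M N =
    (let F = free_module K (carrier M \<times> carrier N); g = (\<lambda>a b. free_gen K (a, b)) in
      {g (a \<oplus>\<^bsub>M\<^esub> a') b \<ominus>\<^bsub>F\<^esub> (g a b \<oplus>\<^bsub>F\<^esub> g a' b) | a a' b.
          a \<in> carrier M \<and> a' \<in> carrier M \<and> b \<in> carrier N}
    \<union> {g a (b \<oplus>\<^bsub>N\<^esub> b') \<ominus>\<^bsub>F\<^esub> (g a b \<oplus>\<^bsub>F\<^esub> g a b') | a b b'.
          a \<in> carrier M \<and> b \<in> carrier N \<and> b' \<in> carrier N}
    \<union> {g (k \<odot>\<^bsub>M\<^esub> a) b \<ominus>\<^bsub>F\<^esub> k \<odot>\<^bsub>F\<^esub> g a b | k a b.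
          k \<in> carrier K \<and> a \<in> carrier M \<and> b \<in> carrier N}
    \<union> {g a (k \<odot>\<^bsub>N\<^esub> b) \<ominus>\<^bsub>F\<^esub> k \<odot>\<^bsub>F\<^esub> g a b | k a b.
          k \<in> carrier K \<and> a \<in> carrier M \<and> b \<in> carrier N})"

definition tensor_kernel ::
    "('k, 'r) ring_scheme \<Rightarrow> ('k, 'a, 'm) module_scheme \<Rightarrow> ('k, 'b, 'n) module_scheme
      \<Rightarrow> ('a \<times> 'b \<Rightarrow> 'k) set"
  where "tensor_kernel K M N =
    submodule_span K (free_module K (carrier M \<times> carrier N)) (tensor_relations K M N)"

definition tensor_product ::
    "('k, 'r) ring_scheme \<Rightarrow> ('k, 'a, 'm) module_scheme \<Rightarrow> ('k, 'b, 'n) module_scheme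
      \<Rightarrow> ('k, ('a \<times> 'b \<Rightarrow> 'k) set) module"
  where "tensor_product K M N =
    quotient_module (free_module K (carrier M \<times> carrier N)) (tensor_kernel K M N)"

definition pure_tensor ::
    "('k, 'r) ring_scheme \<Rightarrow> ('k, 'a, 'm) module_scheme \<Rightarrow> ('k, 'b, 'n) module_scheme
      \<Rightarrow> 'a \<Rightarrow> 'b \<Rightarrow> ('a \<times> 'b \<Rightarrow> 'k) set"
  where "pure_tensor K M N a b =
    tensor_kernel K M N +>\<^bsub>free_module K (carrier M \<times> carrier N)\<^esub> free_gen K (a, b)"

section \<open>T-algebras\<close>

locale index_semigroup =
  fixes P :: "('p, 'q) monoid_scheme" (structure)
  assumes m_closed: "\<lbrakk>p \<in> carrier P; q \<in> carrier P\<rbrakk> \<Longrightarrow> p \<otimes> q \<in> carrier P"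
    and m_assoc: "\<lbrakk>p \<in> carrier P; q \<in> carrier P; t \<in> carrier P\<rbrakk> \<Longrightarrow> (p \<otimes> q) \<otimes> t = p \<otimes> (q \<otimes> t)"

definition tprod ::
    "('k, 'r) ring_scheme \<Rightarrow> ('p \<Rightarrow> ('k, 'a, 'm) module_scheme)
      \<Rightarrow> ('p \<Rightarrow> 'p \<Rightarrow> ('a \<times> 'a \<Rightarrow> 'k) set \<Rightarrow> 'a) \<Rightarrow> 'p \<Rightarrow> 'p \<Rightarrow> 'a \<Rightarrow> 'a \<Rightarrow> 'a"
  where "tprod K A \<mu> p q a b = \<mu> p q (pure_tensor K (A p) (A q) a b)"

locale T_algebra =
  fixes K :: "('k, 'r) ring_scheme"
    and P :: "('p, 'q) monoid_scheme"
    and A :: "'p \<Rightarrow> ('k, 'a, 'm) module_scheme"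
    and \<mu> :: "'p \<Rightarrow> 'p \<Rightarrow> ('a \<times> 'a \<Rightarrow> 'k) set \<Rightarrow> 'a"
  assumes field: "field K"
    and semigroup: "index_semigroup P"
    and vector_space: "p \<in> carrier P \<Longrightarrow> module K (A p)"
    and mu_linear: "\<lbrakk>p \<in> carrier P; q \<in> carrier P\<rbrakk> \<Longrightarrow>
      \<mu> p q \<in> linear_hom K (tensor_product K (A p) (A q)) (A (p \<otimes>\<^bsub>P\<^esub> q))"
    and assoc: "\<lbrakk>p \<in> carrier P; q \<in> carrier P; t \<in> carrier P;
        a \<in> carrier (A p); b \<in> carrier (A q); c \<in> carrier (A t)\<rbrakk> \<Longrightarrow>
      tprod K A \<mu> (p \<otimes>\<^bsub>P\<^esub> q) t (tprod K A \<mu> p q a b) c =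
      tprod K A \<mu> p (q \<otimes>\<^bsub>P\<^esub> t) a (tprod K A \<mu> q t b c)"

locale unital_T_algebra = T_algebra K P A \<mu>
  for K :: "('k, 'r) ring_scheme"
    and P :: "('p, 'q) monoid_scheme"
    and A :: "'p \<Rightarrow> ('k, 'a, 'm) module_scheme"
    and \<mu> :: "'p \<Rightarrow> 'p \<Rightarrow> ('a \<times> 'a \<Rightarrow> 'k) set \<Rightarrow> 'a" +
  assumes monoid: "monoid P"
    and unital: "\<exists>\<eta> \<in> linear_hom K (self_module K) (A \<one>\<^bsub>P\<^esub>).
      \<forall>p \<in> carrier P. \<forall>a \<in> carrier (A p).
        tprod K A \<mu> p \<one>\<^bsub>P\<^esub> a (\<eta> \<one>\<^bsub>K\<^esub>) = a \<and> tprod K A \<mu> \<one>\<^bsub>P\<^esub> p (\<eta> \<one>\<^bsub>K\<^esub>) a = a"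

definition linear_family ::
    "('k, 'r) ring_scheme \<Rightarrow> ('p, 'q) monoid_scheme \<Rightarrow> ('p \<Rightarrow> ('k, 'a, 'm) module_scheme)
      \<Rightarrow> ('p \<Rightarrow> 'a \<Rightarrow> 'a) \<Rightarrow> bool"
  where "linear_family K P A R \<longleftrightarrow> (\<forall>p \<in> carrier P. R p \<in> linear_hom K (A p) (A p))"

locale Rota_Baxter_T_algebra = T_algebra K P A \<mu>
  for K :: "('k, 'r) ring_scheme"
    and P :: "('p, 'q) monoid_scheme"
    and A :: "'p \<Rightarrow> ('k, 'a, 'm) module_scheme"
    and \<mu> :: "'p \<Rightarrow> 'p \<Rightarrow> ('a \<times> 'a \<Rightarrow> 'k) set \<Rightarrow> 'a" +
  fixes w :: 'k and R :: "'p \<Rightarrow> 'a \<Rightarrow> 'a"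
  assumes weight: "w \<in> carrier K"
    and R_linear: "linear_family K P A R"
    and Rota_Baxter: "\<lbrakk>p \<in> carrier P; q \<in> carrier P; a \<in> carrier (A p); b \<in> carrier (A q)\<rbrakk> \<Longrightarrow>
      tprod K A \<mu> p q (R p a) (R q b) =
      R (p \<otimes>\<^bsub>P\<^esub> q)
        (tprod K A \<mu> p q (R p a) b
          \<oplus>\<^bsub>A (p \<otimes>\<^bsub>P\<^esub> q)\<^esub> tprod K A \<mu> p q a (R q b)
          \<oplus>\<^bsub>A (p \<otimes>\<^bsub>P\<^esub> q)\<^esub> w \<odot>\<^bsub>A (p \<otimes>\<^bsub>P\<^esub> q)\<^esub> tprod K A \<mu> p q a b)"

definition T_quasi_idempotent ::
    "('k, 'r) ring_scheme \<Rightarrow> ('p, 'q) monoid_scheme \<Rightarrow> ('p \<Rightarrow> ('k, 'a, 'm) module_scheme)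
      \<Rightarrow> 'k \<Rightarrow> ('p \<Rightarrow> 'a \<Rightarrow> 'a) \<Rightarrow> bool"
  where "T_quasi_idempotent K P A w R \<longleftrightarrow>
    linear_family K P A R \<and>
    (\<forall>p \<in> carrier P. \<forall>a \<in> carrier (A p). R p (R p a) = (\<ominus>\<^bsub>K\<^esub> w) \<odot>\<^bsub>A p\<^esub> R p a)"

definition left_A_linear ::
    "('k, 'r) ring_scheme \<Rightarrow> ('p, 'q) monoid_scheme \<Rightarrow> ('p \<Rightarrow> ('k, 'a, 'm) module_scheme)
      \<Rightarrow> ('p \<Rightarrow> 'p \<Rightarrow> ('a \<times> 'a \<Rightarrow> 'k) set \<Rightarrow> 'a) \<Rightarrow> ('p \<Rightarrow> 'a \<Rightarrow> 'a) \<Rightarrow> bool"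
  where "left_A_linear K P A \<mu> R \<longleftrightarrow>
    (\<forall>p \<in> carrier P. \<forall>q \<in> carrier P. \<forall>a \<in> carrier (A p). \<forall>b \<in> carrier (A q).
      R (p \<otimes>\<^bsub>P\<^esub> q) (tprod K A \<mu> p q a b) = tprod K A \<mu> p q a (R q b))"

end

theory Submission
  imports Defs
begin

text \<open>
  By left linearity, \<open>R\<^sub>p\<^sub>q (R\<^sub>p a \<cdot> b) = R\<^sub>p a \<cdot> R\<^sub>q b\<close> and \<open>R\<^sub>p\<^sub>q (a \<cdot> R\<^sub>q b) = R\<^sub>p\<^sub>q (R\<^sub>p\<^sub>q (a \<cdot> b))\<close>,
  so the Rota-Baxter identity says exactly that \<open>R\<^sup>2 + \<lambda> R\<close> vanishes on all products \<open>a \<cdot> b\<close>.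
  Since \<open>A\<close> is unital, every element is such a product.
\<close>

lemma linear_hom_closed:
  "f \<in> linear_hom K M N \<Longrightarrow> x \<in> carrier M \<Longrightarrow> f x \<in> carrier N"
  by (auto simp: linear_hom_def hom_def)

lemma linear_hom_add:
  "f \<in> linear_hom K M N \<Longrightarrow> x \<in> carrier M \<Longrightarrow> y \<in> carrier M \<Longrightarrow> f (x \<oplus>\<^bsub>M\<^esub> y) = f x \<oplus>\<^bsub>N\<^esub> f y"
  by (auto simp: linear_hom_def hom_def)

lemma linear_hom_smult:
  "f \<in> linear_hom K M N \<Longrightarrow> k \<in> carrier K \<Longrightarrow> x \<in> carrier M \<Longrightarrow> f (k \<odot>\<^bsub>M\<^esub> x) = k \<odot>\<^bsub>N\<^esub> f x"
  by (auto simp: linear_hom_def)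

text \<open>The generator \<open>free_gen K (a, b)\<close> is supported in at most one point, so it
  lies in the free module, and its coset is by construction an element of the quotient.\<close>

lemma pure_tensor_closed:
  assumes "ring K" "a \<in> carrier M" "b \<in> carrier N"
  shows "pure_tensor K M N a b \<in> carrier (tensor_product K M N)"
proof -
  interpret ring K by fact
  let ?F = "free_module K (carrier M \<times> carrier N)"
  have "{x. free_gen K (a, b) x \<noteq> \<zero>\<^bsub>K\<^esub>} \<subseteq> {(a, b)}"
    by (auto simp: free_gen_def)
  then have "finite {x. free_gen K (a, b) x \<noteq> \<zero>\<^bsub>K\<^esub>}"
    by (rule finite_subset) simp
  then have "free_gen K (a, b) \<in> carrier ?F"
    using assms by (auto simp: free_module_def free_gen_def)
  then show ?thesis
    by (auto simp: pure_tensor_def tensor_product_def quotient_module_def A_RCOSETS_def'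
        a_r_coset_def')
qed

lemma (in T_algebra) tprod_closed:
  assumes "p \<in> carrier P" "q \<in> carrier P" "a \<in> carrier (A p)" "b \<in> carrier (A q)"
  shows "tprod K A \<mu> p q a b \<in> carrier (A (p \<otimes>\<^bsub>P\<^esub> q))"
proof -
  interpret field K by (rule field)
  show ?thesis
    unfolding tprod_def using assms
    by (intro linear_hom_closed[OF mu_linear] pure_tensor_closed ring_axioms)
qed

text \<open>Cancellation in the Rota-Baxter identity yields a vanishing sum; this converts it to the
  shape with a negated scalar used by \<open>T_quasi_idempotent\<close>.\<close>

lemma (in module) add_smult_eq_zero_iff:
  assumes "k \<in> carrier R" "x \<in> carrier M" "y \<in> carrier M"
  shows "y \<oplus>\<^bsub>M\<^esub> k \<odot>\<^bsub>M\<^esub> x = \<zero>\<^bsub>M\<^esub> \<longleftrightarrow> y = (\<ominus> k) \<odot>\<^bsub>M\<^esub> x"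
  using assms by (metis M.minus_equality M.l_neg smult_closed smult_l_minus)

text \<open>Keeping \<open>p\<close>, \<open>q\<close>, \<open>a\<close>, \<open>b\<close> fixed
  lets one equivalence serve both directions of the theorem: one direction specializes the left
  factor to the unit, the other lets the pair range freely.\<close>

lemma (in T_algebra) Rota_Baxter_iff_on_tprod:
  assumes w: "w \<in> carrier K" and lin: "linear_family K P A R"
    and left: "left_A_linear K P A \<mu> R"
    and p: "p \<in> carrier P" and q: "q \<in> carrier P"
    and a: "a \<in> carrier (A p)" and b: "b \<in> carrier (A q)"
  shows "tprod K A \<mu> p q (R p a) (R q b) =
      R (p \<otimes>\<^bsub>P\<^esub> q)
        (tprod K A \<mu> p q (R p a) b
          \<oplus>\<^bsub>A (p \<otimes>\<^bsub>P\<^esub> q)\<^esub> tprod K A \<mu> p q a (R q b)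
          \<oplus>\<^bsub>A (p \<otimes>\<^bsub>P\<^esub> q)\<^esub> w \<odot>\<^bsub>A (p \<otimes>\<^bsub>P\<^esub> q)\<^esub> tprod K A \<mu> p q a b)
    \<longleftrightarrow> R (p \<otimes>\<^bsub>P\<^esub> q) (R (p \<otimes>\<^bsub>P\<^esub> q) (tprod K A \<mu> p q a b)) =
        (\<ominus>\<^bsub>K\<^esub> w) \<odot>\<^bsub>A (p \<otimes>\<^bsub>P\<^esub> q)\<^esub> R (p \<otimes>\<^bsub>P\<^esub> q) (tprod K A \<mu> p q a b)"
proof -
  let ?r = "p \<otimes>\<^bsub>P\<^esub> q"
  let ?M = "A ?r"
  have r: "?r \<in> carrier P"
    using semigroup p q by (rule index_semigroup.m_closed)
  interpret module K ?M
    using r by (rule vector_space)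
  have hom: "R s \<in> linear_hom K (A s) (A s)" if "s \<in> carrier P" for s
    using lin that by (simp add: linear_family_def)
  note closed = linear_hom_closed[OF hom]
  note left' = left[unfolded left_A_linear_def, rule_format]
  define x where "x = tprod K A \<mu> p q (R p a) b"
  define z where "z = tprod K A \<mu> p q a b"
  have x: "x \<in> carrier ?M" and z: "z \<in> carrier ?M"
    unfolding x_def z_def using p q a b by (auto intro: tprod_closed closed)
  \<comment> \<open>\<open>Rx\<close> and \<open>Rz\<close> read left linearity from right to left,
    with left factors \<open>R p a\<close> and \<open>a\<close> respectively.\<close>
  have Rx: "tprod K A \<mu> p q (R p a) (R q b) = R ?r x"
    unfolding x_def using p q a b by (simp add: left' closed)
  have Rz: "tprod K A \<mu> p q a (R q b) = R ?r z"
    unfolding z_def using p q a b by (simp add: left')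
  have c: "R ?r x \<in> carrier ?M" "R ?r z \<in> carrier ?M" "R ?r (R ?r z) \<in> carrier ?M"
    using r x z by (simp_all add: closed)
  \<comment> \<open>The sum is bracketed so that \<open>R ?r x\<close>, which by \<open>Rx\<close>
    is the left side of the Rota-Baxter identity, stands alone and can be cancelled.\<close>
  have "R ?r (x \<oplus>\<^bsub>?M\<^esub> R ?r z \<oplus>\<^bsub>?M\<^esub> w \<odot>\<^bsub>?M\<^esub> z) =
      R ?r x \<oplus>\<^bsub>?M\<^esub> (R ?r (R ?r z) \<oplus>\<^bsub>?M\<^esub> w \<odot>\<^bsub>?M\<^esub> R ?r z)"
    using x z c w
    by (simp add: linear_hom_add[OF hom[OF r]] linear_hom_smult[OF hom[OF r]] M.a_assoc)
  then show ?thesis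
    unfolding Rx Rz x_def[symmetric] z_def[symmetric]
    using c w add_smult_eq_zero_iff[OF w c(2,3)] M.add.r_cancel_one' by simp
qed

theorem proposition2p6:
  fixes K :: "('k, 'r) ring_scheme"
    and P :: "('p, 'q) monoid_scheme"
    and A :: "'p \<Rightarrow> ('k, 'a, 'm) module_scheme"
    and \<mu> :: "'p \<Rightarrow> 'p \<Rightarrow> ('a \<times> 'a \<Rightarrow> 'k) set \<Rightarrow> 'a"
    and w :: 'k
    and R :: "'p \<Rightarrow> 'a \<Rightarrow> 'a"
  assumes "field K"
    and "monoid P"
    and "unital_T_algebra K P A \<mu>"
    and "w \<in> carrier K"
    and "linear_family K P A R"
    and "left_A_linear K P A \<mu> R"
  shows "Rota_Baxter_T_algebra K P A \<mu> w R \<longleftrightarrow> T_quasi_idempotent K P A w R"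
proof -
  interpret unital_T_algebra K P A \<mu> by fact
  interpret P: monoid P by fact
  interpret K: field K by fact
  note RB_iff = Rota_Baxter_iff_on_tprod[OF assms(4-6)]
  show ?thesis
  proof
    assume "Rota_Baxter_T_algebra K P A \<mu> w R"
    then interpret RB: Rota_Baxter_T_algebra K P A \<mu> w R .
    obtain \<eta> where \<eta>: "\<eta> \<in> linear_hom K (self_module K) (A \<one>\<^bsub>P\<^esub>)"
      and unit: "\<And>p a. p \<in> carrier P \<Longrightarrow> a \<in> carrier (A p) \<Longrightarrow>
        tprod K A \<mu> \<one>\<^bsub>P\<^esub> p (\<eta> \<one>\<^bsub>K\<^esub>) a = a"
      using unital by blast
    have \<eta>_one: "\<eta> \<one>\<^bsub>K\<^esub> \<in> carrier (A \<one>\<^bsub>P\<^esub>)"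
      using \<eta> by (rule linear_hom_closed) (simp add: self_module_def)
    have "R p (R p a) = (\<ominus>\<^bsub>K\<^esub> w) \<odot>\<^bsub>A p\<^esub> R p a"
      if p: "p \<in> carrier P" and a: "a \<in> carrier (A p)" for p a
      \<comment> \<open>The left factor is the unit element \<open>\<eta> \<one>\<close>, with index
        \<open>\<one>\<close>: the product is then \<open>a\<close> itself and the index
        \<open>\<one> \<otimes> p\<close> collapses to \<open>p\<close>.\<close>
      using iffD1[OF RB_iff[OF P.one_closed p \<eta>_one a] RB.Rota_Baxter[OF P.one_closed p \<eta>_one a]]
      by (simp add: unit p a)
    then show "T_quasi_idempotent K P A w R"
      using assms(5) by (simp add: T_quasi_idempotent_def)
  next
    assume "T_quasi_idempotent K P A w R"
    then show "Rota_Baxter_T_algebra K P A \<mu> w R"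
      using assms(4,5)
      \<comment> \<open>Quasi-idempotence at the index \<open>p \<otimes> q\<close> is applied to
        the product of \<open>a\<close> and \<open>b\<close>, which lies in the right carrier by
        \<open>tprod_closed\<close>.\<close>
      by unfold_locales (auto simp: T_quasi_idempotent_def RB_iff tprod_closed)
  qed
qed

end
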